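(* Let $S \in \mathcal{S}^n_{+}\setminus\{0\}$ and let $L \subseteq \mathcal{S}^n$ be a linear subspace such that $L \cap \mathcal{S}^n_{++} \neq \emptyset$. Then the following are equivalent: (1) there is a (unique) optimum solution to the problem of minimizing $\mathrm{Tr}(SK)-\log\det K$ subject to $K\in\mathcal{S}^n_{++}$ and $K\in L$; (2) there exists a matrix $K \in \mathcal{S}^n_{++}$ such that $S - K^{-1} \in L^\perp$; (3) there does not exist a non-zero matrix $\Omega \in \mathcal{S}^n_{+}\cap L$ such that $\mathrm{Tr}(\Omega S) = 0$ (equivalently, such that $\Omega S = 0$). In this case, the optimum is the unique matrix $K$ satisfying $K \in L \cap \mathcal{S}^n_{++}$ and $S - K^{-1} \in L^\perp$.
   Context: $\mathcal{S}^n$ is the vector space of real symmetric $n\times n$ matrices ($n\ge1$) with inner product $\langle A,B\rangle=\mathrm{Tr}(AB)$; $\mathcal{S}^n_+$ is the cone of positive semidefinite matrices and $\mathcal{S}^n_{++}$ the open cone of positive definite matrices. $L^\perp$ denotes the orthogonal complement of $L$ in $\mathcal{S}^n$ with respect to this inner product. *)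

theory Defs
  imports "HOL-Analysis.Analysis"
begin

definition sym_mats :: "(real^'n^'n) set" where
  "sym_mats = {A. transpose A = A}"

definition psd_mats :: "(real^'n^'n) set" where
  "psd_mats = {A \<in> sym_mats. \<forall>x. 0 \<le> x \<bullet> (A *v x)}"

definition pd_mats :: "(real^'n^'n) set" where
  "pd_mats = {A \<in> sym_mats. \<forall>x. x \<noteq> 0 \<longrightarrow> 0 < x \<bullet> (A *v x)}"

(* The complement is taken inside the symmetric matrices, not in real^'n^'n;
   this is why the library's orthogonal_comp is not used. *)
definition sym_perp :: "(real^'n^'n) set \<Rightarrow> (real^'n^'n) set" where
  "sym_perp L = {A \<in> sym_mats. \<forall>B\<in>L. trace (A ** B) = 0}"

definition objective :: "real^'n^'n \<Rightarrow> real^'n^'n \<Rightarrow> real" where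
  "objective S K = trace (S ** K) - ln (det K)"

definition is_optimum :: "real^'n^'n \<Rightarrow> (real^'n^'n) set \<Rightarrow> real^'n^'n \<Rightarrow> bool" where
  "is_optimum S L K \<longleftrightarrow> is_arg_min (objective S) (\<lambda>K. K \<in> pd_mats \<and> K \<in> L) K"

end

theory Submission
  imports Defs
begin

text \<open>
  The function \<open>ln det\<close> is strictly concave on the positive definite matrices, with gradient \<open>K^{-1}\<close> at
  \<open>K\<close>. The problem therefore minimizes a strictly convex function over \<open>L \<inter> pd_mats\<close>, which is
  relatively open in \<open>L\<close>. There are no boundary conditions: a feasible \<open>K\<close> is optimal exactly if the
  gradient \<open>S - K^{-1}\<close> is orthogonal to \<open>L\<close>, and strict convexity makes it unique
  (\<open>optimum_iff_stationary\<close>, \<open>optimum_unique\<close>).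

  The only question is existence. A non-zero semidefinite \<open>\<Omega>\<close> in \<open>L\<close> with \<open>Tr (\<Omega> S) = 0\<close> is a
  direction in which the trace term does not grow. If a definite \<open>K\<close>, in \<open>L\<close> or not, satisfies
  \<open>S - K^{-1} \<in> sym_perp L\<close>, no such direction exists, because \<open>Tr (\<Omega> S) = Tr (K^{-1} \<Omega>)\<close> is positive
  (\<open>stationary_imp_no_recession\<close>). Conversely, if there is no such direction, then by compactness
  \<open>Tr (A S)\<close> grows linearly on the semidefinite part of \<open>L\<close> and beats the logarithm. The sublevel sets
  are then bounded and stay away from the singular matrices, so that the minimum is attained
  (\<open>trace_coercive\<close>, \<open>ln_det_le_norm\<close>, \<open>optimum_exists\<close>).

  The computations with determinants and traces rest on one tool. A definite \<open>K\<close> and a symmetric \<open>B\<close> can be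
  diagonalized by the same congruence, with \<open>K\<close> going to the identity (\<open>simultaneous_diagonalization\<close>).
  The resulting eigenvalues (\<open>pencil_eigenvalues\<close>) reduce the concavity inequality (\<open>ln_det_le\<close>) and
  the derivative of \<open>ln det\<close> along a line to statements on the scalar logarithm.
\<close>

section \<open>Simultaneous diagonalization\<close>

lemma sym_mats_vector_matrix: assumes "(A::real^'n^'n) \<in> sym_mats"
  shows "x v* A = A *v x"
proof -
  have "transpose A = A" using assms by (simp add: sym_mats_def)
  then have "transpose A *v x = A *v x" by (simp only:)
  then show ?thesis by (simp only: transpose_matrix_vector)
qed

lemma sym_mats_dot: assumes "(A::real^'n^'n) \<in> sym_mats"
  shows "x \<bullet> (A *v y) = y \<bullet> (A *v x)"
proof -
  have "x \<bullet> (A *v y) = (x v* A) \<bullet> y" by (rule dot_lmul_matrix[symmetric])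
  also have "\<dots> = y \<bullet> (A *v x)"
    unfolding sym_mats_vector_matrix[OF assms] by (rule inner_commute)
  finally show ?thesis .
qed

lemma quadratic_form_add:
  assumes "A \<in> sym_mats"
  shows "(v + t *\<^sub>R w) \<bullet> (A *v (v + t *\<^sub>R w))
    = v \<bullet> (A *v v) + 2 * t * (v \<bullet> (A *v w)) + t\<^sup>2 * (w \<bullet> (A *v w))"
proof -
  have "(v + t *\<^sub>R w) \<bullet> (A *v (v + t *\<^sub>R w))
    = v \<bullet> (A *v v) + t * (v \<bullet> (A *v w)) + t * (w \<bullet> (A *v v)) + t\<^sup>2 * (w \<bullet> (A *v w))"
    by (simp only: matrix_vector_right_distrib matrix_vector_mult_scaleR inner_add_left
        inner_add_right inner_scaleR_left inner_scaleR_right)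
      (simp add: power2_eq_square distrib_left)
  moreover have "w \<bullet> (A *v v) = v \<bullet> (A *v w)"
    by (rule sym_mats_dot[OF assms])
  ultimately show ?thesis by simp
qed

text \<open>
  As \<open>v\<close> is isotropic, the form equals \<open>2 t a + t\<^sup>2 b\<close> at \<open>v + t w\<close>, where \<open>a = v \<bullet> A w\<close> and \<open>b = w \<bullet> A w\<close>. If \<open>a\<close>
  were non-zero, the linear term would dominate near \<open>t = 0\<close> and make the form negative there.
\<close>

lemma semidefinite_isotropic_imp_radical:
  assumes "subspace V" "A \<in> sym_mats" "\<And>x. x \<in> V \<Longrightarrow> 0 \<le> x \<bullet> (A *v x)"
    and "v \<in> V" "w \<in> V" "v \<bullet> (A *v v) = 0"
  shows "v \<bullet> (A *v w) = 0"
proof -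
  define a where "a = v \<bullet> (A *v w)"
  define b where "b = w \<bullet> (A *v w)"
  have q: "0 \<le> 2 * t * a + t\<^sup>2 * b" for t
  proof -
    have "v + t *\<^sub>R w \<in> V"
      using assms by (simp add: subspace_add subspace_mul)
    then show ?thesis
      using assms(3)[of "v + t *\<^sub>R w"] quadratic_form_add[OF assms(2), of v t w] assms(6)
      by (simp add: a_def b_def)
  qed
  have b0: "0 \<le> b" using assms by (simp add: b_def)
  \<comment> \<open>The minimizing value would be \<open>t = - a / b\<close>; the shift to \<open>b + 1\<close> covers \<open>b = 0\<close> as well.\<close>
  have "0 \<le> 2 * (- a / (b + 1)) * a + (- a / (b + 1))\<^sup>2 * b" by (rule q)
  also have "\<dots> = - (a\<^sup>2 * (b + 2)) / (b + 1)\<^sup>2"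
    using b0 by (simp add: field_simps power2_eq_square add_nonneg_eq_0_iff)
  finally have "a\<^sup>2 * (b + 2) \<le> 0"
    using b0 by (simp add: field_simps zero_le_divide_iff) 
  then have "a = 0" using b0 by (simp add: mult_le_0_iff)
  then show ?thesis by (simp add: a_def)
qed

text \<open>
  The quotient \<open>x \<bullet> B x / x \<bullet> K x\<close> does not change when \<open>x\<close> is scaled, so its maximum over the
  unit vectors of \<open>V\<close>, which exists by compactness, bounds it on all of \<open>V\<close>.
\<close>

lemma rayleigh_maximizer:
  fixes K B :: "real^'n^'n"
  assumes "K \<in> pd_mats" "subspace V" "V \<noteq> {0}"
  obtains v l where "v \<in> V" "v \<noteq> 0" "v \<bullet> (B *v v) = l * (v \<bullet> (K *v v))"
    "\<And>x. x \<in> V \<Longrightarrow> x \<bullet> (B *v x) \<le> l * (x \<bullet> (K *v x))"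
proof -
  let ?q = "\<lambda>x. (x \<bullet> (B *v x)) / (x \<bullet> (K *v x))"
  have pos: "0 < x \<bullet> (K *v x)" if "x \<noteq> 0" for x
    using assms that by (simp add: pd_mats_def)
  have "0 \<in> V" using assms(2) by (simp add: subspace_0)
  then obtain y where y: "y \<in> V" "y \<noteq> 0" using assms(3) by blast
  then have "(1 / norm y) *\<^sub>R y \<in> V \<inter> sphere 0 1"
    using assms(2) by (simp add: subspace_mul)
  then have "V \<inter> sphere 0 1 \<noteq> {}" by blast
  moreover have "compact (V \<inter> sphere 0 1)"
    by (simp add: assms(2) closed_subspace closed_Int_compact)
  moreover have "continuous_on (V \<inter> sphere 0 1) ?q"
  proof (intro continuous_intros ballI)
    fix x :: "real^'n" assume "x \<in> V \<inter> sphere 0 1"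
    then show "x \<bullet> (K *v x) \<noteq> 0" using pos[of x] by force
  qed
  ultimately obtain v where v: "v \<in> V \<inter> sphere 0 1"
    and max: "\<And>x. x \<in> V \<inter> sphere 0 1 \<Longrightarrow> ?q x \<le> ?q v"
    using continuous_attains_sup[of "V \<inter> sphere 0 1" ?q] by blast
  have v0: "v \<noteq> 0" using v by auto
  have "x \<bullet> (B *v x) \<le> ?q v * (x \<bullet> (K *v x))" if "x \<in> V" for x
  proof (cases "x = 0")
    case False
    then have "(1 / norm x) *\<^sub>R x \<in> V \<inter> sphere 0 1"
      using that assms(2) by (simp add: subspace_mul)
    from max[OF this] have "?q x \<le> ?q v"
      using False by (simp add: matrix_vector_mult_scaleR)
    then show ?thesis
      using pos[OF False] by (simp add: pos_divide_le_eq)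
  qed simp
  then show thesis
    using that[of v "?q v"] v v0 pos[OF v0] by auto
qed

text \<open>
  This is the spectral theorem for \<open>B\<close> in the inner product given by \<open>K\<close>. A maximizer \<open>v\<close> of the
  Rayleigh quotient, with maximum \<open>l\<close>, is isotropic for the form \<open>l K - B\<close>, which is positive
  semidefinite on \<open>V\<close>; hence \<open>v \<bullet> B w = l (v \<bullet> K w)\<close> for all \<open>w\<close> in \<open>V\<close>. So the vectors of \<open>V\<close> that
  are \<open>K\<close>-orthogonal to \<open>v\<close> are also \<open>B\<close>-orthogonal to it, and they form a subspace of dimension
  one less, to which the induction hypothesis applies. An arbitrary subspace, rather than a
  smaller matrix size, carries the induction because the size is a type.
\<close>

lemma common_orthogonal_set:
  fixes K B :: "real^'n^'n"
  assumes K: "K \<in> pd_mats" and B: "B \<in> sym_mats" and "subspace V"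
  shows "\<exists>E\<subseteq>V. finite E \<and> card E = dim V \<and> (\<forall>x\<in>E. x \<bullet> (K *v x) = 1)
    \<and> (\<forall>x\<in>E. \<forall>y\<in>E. x \<noteq> y \<longrightarrow> x \<bullet> (K *v y) = 0 \<and> x \<bullet> (B *v y) = 0)"
  using \<open>subspace V\<close>
proof (induction "dim V" arbitrary: V)
  case 0
  then show ?case by (intro exI[of _ "{}"]) auto
next
  case (Suc m)
  have Ks: "K \<in> sym_mats" using K by (simp add: pd_mats_def)
  have "V \<noteq> {0}" using Suc.hyps(2) by auto
  then obtain v l where v: "v \<in> V" "v \<noteq> 0" "v \<bullet> (B *v v) = l * (v \<bullet> (K *v v))"
    and max: "\<And>x. x \<in> V \<Longrightarrow> x \<bullet> (B *v x) \<le> l * (x \<bullet> (K *v x))"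
    using rayleigh_maximizer[OF K \<open>subspace V\<close>] by metis
  define u where "u = (1 / sqrt (v \<bullet> (K *v v))) *\<^sub>R v"
  have vKv: "0 < v \<bullet> (K *v v)" using K v(2) by (simp add: pd_mats_def)
  have uV: "u \<in> V" using v(1) Suc.prems by (simp add: u_def subspace_mul)
  have uKu: "u \<bullet> (K *v u) = 1"
    using vKv by (simp add: u_def matrix_vector_mult_scaleR power2_eq_square[symmetric])
  define C where "C = l *\<^sub>R K - B"
  have Cs: "C \<in> sym_mats"
    using Ks B by (simp add: C_def sym_mats_def transpose_def vec_eq_iff)
  have Cdot: "x \<bullet> (C *v y) = l * (x \<bullet> (K *v y)) - x \<bullet> (B *v y)" for x y
    by (simp add: C_def matrix_vector_mult_diff_rdistrib inner_diff_right
        scaleR_matrix_vector_assoc[symmetric])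
  have vC: "v \<bullet> (C *v w) = 0" if "w \<in> V" for w
    by (rule semidefinite_isotropic_imp_radical[OF Suc.prems Cs _ v(1) that])
      (use max v(3) in \<open>auto simp: Cdot\<close>)
  have uB: "u \<bullet> (B *v w) = l * (u \<bullet> (K *v w))" if "w \<in> V" for w
    using vC[OF that] by (simp add: u_def Cdot)
  define W where "W = {x \<in> V. u \<bullet> (K *v x) = 0}"
  have W: "subspace W"
    using Suc.prems unfolding W_def subspace_def
    by (auto simp: matrix_vector_right_distrib inner_add_right matrix_vector_mult_scaleR)
  have "span (insert u W) = V"
  proof
    show "span (insert u W) \<subseteq> V"
      by (rule span_minimal) (use uV Suc.prems in \<open>auto simp: W_def\<close>)
    show "V \<subseteq> span (insert u W)"
    proof
      fix x assume "x \<in> V"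
      then have "x - (u \<bullet> (K *v x)) *\<^sub>R u \<in> W"
        using uV Suc.prems uKu
        by (simp add: W_def subspace_diff subspace_mul matrix_vector_mult_diff_distrib
            inner_diff_right matrix_vector_mult_scaleR)
      then show "x \<in> span (insert u W)"
        by (metis insert_iff span_base span_breakdown_eq)
    qed
  qed
  moreover have "u \<notin> span W"
    using W uKu by (simp add: span_eq_iff[THEN iffD2] W_def)
  ultimately have "dim V = dim W + 1"
    by (metis dim_insert dim_span)
  then have m: "m = dim W" using Suc.hyps(2) by simp
  obtain E where E: "E \<subseteq> W" "finite E" "card E = dim W" "\<forall>x\<in>E. x \<bullet> (K *v x) = 1"
    "\<forall>x\<in>E. \<forall>y\<in>E. x \<noteq> y \<longrightarrow> x \<bullet> (K *v y) = 0 \<and> x \<bullet> (B *v y) = 0"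
    using Suc.hyps(1)[OF m W] by blast
  have uE: "u \<bullet> (K *v w) = 0 \<and> u \<bullet> (B *v w) = 0" if "w \<in> E" for w
    using that E(1) uB[of w] by (auto simp: W_def)
  then have uE': "w \<bullet> (K *v u) = 0 \<and> w \<bullet> (B *v u) = 0" if "w \<in> E" for w
    using that sym_mats_dot[OF Ks, of u w] sym_mats_dot[OF B, of u w] by auto
  have "u \<notin> E" using uE uKu by fastforce
  then show ?case
    using E uE uE' uV uKu m Suc.hyps(2)
    by (intro exI[of _ "insert u E"]) (auto simp: W_def)
qed

definition diag_mat :: "('n \<Rightarrow> real) \<Rightarrow> real^'n^'n" where
  "diag_mat d = (\<chi> i j. if i = j then d i else 0)"

lemma transpose_mult_mult_nth:
  fixes P :: "real^'m^'n"
  shows "(transpose P ** A ** P) $ i $ j = column i P \<bullet> (A *v column j P)"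
  unfolding matrix_mul_assoc[symmetric]
  by (simp add: matrix_matrix_mult_def matrix_vector_mult_def inner_vec_def transpose_def column_def)

text \<open>
  The columns of \<open>P\<close> are the vectors of a \<open>K\<close>-orthonormal, \<open>B\<close>-orthogonal set with as many elements
  as the dimension.
\<close>

theorem simultaneous_diagonalization:
  fixes K B :: "real^'n^'n"
  assumes "K \<in> pd_mats" "B \<in> sym_mats"
  obtains P :: "real^'n^'n" and d where "transpose P ** K ** P = mat 1" "transpose P ** B ** P = diag_mat d"
proof -
  obtain E :: "(real^'n) set" where E: "finite E" "card E = CARD('n)" "\<forall>x\<in>E. x \<bullet> (K *v x) = 1"
    "\<forall>x\<in>E. \<forall>y\<in>E. x \<noteq> y \<longrightarrow> x \<bullet> (K *v y) = 0 \<and> x \<bullet> (B *v y) = 0"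
    using common_orthogonal_set[OF assms subspace_UNIV] by auto
  then obtain e where e: "bij_betw e (UNIV :: 'n set) E"
    using finite_same_card_bij[of "UNIV :: 'n set" E] by auto
  define P where "P = (\<chi> i j. e j $ i)"
  have col: "column j P = e j" for j
    by (simp add: P_def column_def vec_eq_iff)
  have eE: "e i \<in> E" for i using e by (auto simp: bij_betw_def)
  have inj: "e i = e j \<longleftrightarrow> i = j" for i j using e by (auto simp: bij_betw_def inj_on_def)
  have orth: "e i \<bullet> (K *v e j) = 0 \<and> e i \<bullet> (B *v e j) = 0" if "i \<noteq> j" for i j
    using E(4) eE inj[of i j] that by blast
  show thesis
  proof (rule that)
    show "transpose P ** K ** P = mat 1"
      using E(3) eE orth by (auto simp: vec_eq_iff transpose_mult_mult_nth col mat_def)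
    show "transpose P ** B ** P = diag_mat (\<lambda>i. e i \<bullet> (B *v e i))"
      using E(3) eE orth by (auto simp: vec_eq_iff transpose_mult_mult_nth col diag_mat_def)
  qed
qed

section \<open>Eigenvalues of a pencil\<close>

lemma matrix_inv_eqI:
  fixes A B :: "real^'n^'n"
  assumes "A ** B = mat 1"
  shows "matrix_inv A = B"
proof -
  have BA: "B ** A = mat 1" using assms by (simp add: matrix_left_right_inverse)
  have "A ** matrix_inv A = mat 1 \<and> matrix_inv A ** A = mat 1"
    unfolding matrix_inv_def by (rule someI[of _ B]) (use assms BA in auto)
  then show ?thesis
    by (metis BA matrix_mul_assoc matrix_mul_lid matrix_mul_rid)
qed

text \<open>
  This removes the inverse from traces: \<open>Tr (K^{-1} B) = Tr (P P\<^sup>T B) = Tr (P\<^sup>T B P)\<close>.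
\<close>

lemma matrix_inv_of_congruence_to_identity:
  fixes K P :: "real^'n^'n"
  assumes "transpose P ** K ** P = mat 1"
  shows "matrix_inv K = P ** transpose P"
proof -
  have "P ** (transpose P ** K) = mat 1"
    using assms by (metis matrix_left_right_inverse)
  then have "K ** (P ** transpose P) = mat 1"
    by (metis matrix_left_right_inverse matrix_mul_assoc)
  then show ?thesis by (rule matrix_inv_eqI)
qed

lemma trace_scaleR: "trace (c *\<^sub>R A) = c * trace (A :: real^'n^'n)"
  by (simp add: trace_def sum_distrib_left)

lemma mat_1_pd: "mat 1 \<in> pd_mats"
  by (simp add: pd_mats_def sym_mats_def)

lemma pd_mats_imp_sym: "A \<in> pd_mats \<Longrightarrow> A \<in> sym_mats"
  by (simp add: pd_mats_def)

lemma psd_mats_imp_sym: "A \<in> psd_mats \<Longrightarrow> A \<in> sym_mats"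
  by (simp add: psd_mats_def)

lemma pd_mats_imp_psd: "A \<in> pd_mats \<Longrightarrow> A \<in> psd_mats"
  unfolding pd_mats_def psd_mats_def by (auto, metis inner_zero_left order_less_imp_le order_refl)

lemma dot_diag_mat: "y \<bullet> (diag_mat d *v y) = (\<Sum>i\<in>UNIV. d i * (y $ i)\<^sup>2)"
  by (simp add: diag_mat_def inner_vec_def matrix_vector_mult_def if_distrib
      if_distribR power2_eq_square ac_simps cong: if_cong)

lemma dot_congruence:
  fixes P :: "real^'m^'n"
  shows "y \<bullet> ((transpose P ** A ** P) *v y) = (P *v y) \<bullet> (A *v (P *v y))"
proof -
  have "y \<bullet> ((transpose P ** A ** P) *v y) = y \<bullet> ((A *v (P *v y)) v* P)"
    by (simp add: matrix_vector_mul_assoc[symmetric])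
  also have "\<dots> = (A *v (P *v y)) \<bullet> (P *v y)"
    by (subst inner_commute) (rule dot_lmul_matrix)
  finally show ?thesis by (simp only: inner_commute)
qed

text \<open>
  The numbers \<open>d i\<close> are the eigenvalues of \<open>B\<close> relative to \<open>K\<close>, that is, of \<open>K^{-1} B\<close>. A congruence
  that takes \<open>K\<close> to the identity and \<open>B\<close> to \<open>diag_mat d\<close> takes every member \<open>a K + b B\<close> of the
  pencil to the diagonal matrix with entries \<open>a + b d i\<close>, so that determinant, trace and
  definiteness can all be read off from \<open>d\<close>. Two parameters cover both uses: \<open>a = 0\<close> and \<open>b = 1\<close>
  compare \<open>B\<close> itself with \<open>K\<close>, while \<open>a = 1\<close> and variable \<open>b\<close> move from \<open>K\<close> in the direction \<open>B\<close>.
\<close>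

lemma pencil_eigenvalues:
  fixes K B :: "real^'n^'n"
  assumes K: "K \<in> pd_mats" and B: "B \<in> sym_mats"
  obtains d :: "'n \<Rightarrow> real" where
    "0 < det K"
    "trace (matrix_inv K ** B) = sum d UNIV"
    "\<And>a b. det (a *\<^sub>R K + b *\<^sub>R B) = det K * (\<Prod>i\<in>UNIV. a + b * d i)"
    "\<And>a b. a *\<^sub>R K + b *\<^sub>R B \<in> pd_mats \<longleftrightarrow> (\<forall>i. 0 < a + b * d i)"
    "\<And>a b. a *\<^sub>R K + b *\<^sub>R B \<in> psd_mats \<Longrightarrow> (\<forall>i. 0 \<le> a + b * d i)"
    "\<And>c. (\<forall>i. d i = c) \<Longrightarrow> B = c *\<^sub>R K"
proof -
  obtain P :: "real^'n^'n" and d :: "'n \<Rightarrow> real" where P: "transpose P ** K ** P = mat 1" "transpose P ** B ** P = diag_mat d"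
    by (rule simultaneous_diagonalization[OF assms])
  define R where "R = transpose P ** K"
  have RP: "R ** P = mat 1" using P(1) by (simp add: R_def)
  then have PR: "P ** R = mat 1" by (simp add: matrix_left_right_inverse)
  have PRt: "transpose R ** transpose P = mat 1"
    by (metis PR matrix_transpose_mul transpose_mat)
  have uncong: "A = transpose R ** (transpose P ** A ** P) ** R" for A
    by (metis PR PRt matrix_mul_assoc matrix_mul_lid matrix_mul_rid)
  have cong: "transpose P ** (a *\<^sub>R K + b *\<^sub>R B) ** P = diag_mat (\<lambda>i. a + b * d i)" for a b
  proof -
    have "(transpose P ** (a *\<^sub>R K + b *\<^sub>R B) ** P) $ i $ j
        = a * (transpose P ** K ** P) $ i $ j + b * (transpose P ** B ** P) $ i $ j" for i j
      unfolding transpose_mult_mult_nth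
      by (simp add: matrix_vector_mult_add_rdistrib inner_add_right
          scaleR_matrix_vector_assoc[symmetric])
    then show ?thesis
      by (simp add: P diag_mat_def mat_def vec_eq_iff)
  qed
  have detK: "det K * (det P)\<^sup>2 = 1"
    using arg_cong[OF P(1), of det] by (simp add: det_mul power2_eq_square ac_simps)
  have colne: "column i P \<noteq> 0" for i
    using arg_cong[OF P(1), of "\<lambda>A. A $ i $ i"]
    by (auto simp: transpose_mult_mult_nth mat_def)
  have sym: "a *\<^sub>R K + b *\<^sub>R B \<in> sym_mats" for a b
    using pd_mats_imp_sym[OF K] B by (simp add: sym_mats_def transpose_def vec_eq_iff)
  have coldot: "column i P \<bullet> ((a *\<^sub>R K + b *\<^sub>R B) *v column i P) = a + b * d i" for a b i
    using arg_cong[OF cong[of a b], of "\<lambda>A. A $ i $ i"]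
    by (simp add: transpose_mult_mult_nth diag_mat_def)
  show thesis
  proof (rule that[of d])
    show "0 < det K"
    proof -
      have "0 < det K * (det P)\<^sup>2" using detK by simp
      then show ?thesis by (auto simp: zero_less_mult_iff)
    qed
    have "trace (matrix_inv K ** B) = trace (transpose P ** B ** P)"
      unfolding matrix_inv_of_congruence_to_identity[OF P(1)]
      by (metis matrix_mul_assoc trace_mul_sym)
    then show "trace (matrix_inv K ** B) = sum d UNIV"
      by (simp add: P(2) trace_def diag_mat_def)
    show "det (a *\<^sub>R K + b *\<^sub>R B) = det K * (\<Prod>i\<in>UNIV. a + b * d i)" for a b
    proof -
      have "det (a *\<^sub>R K + b *\<^sub>R B) * (det P)\<^sup>2 = (\<Prod>i\<in>UNIV. a + b * d i)"
        using arg_cong[OF cong[of a b], of det]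
        by (simp add: det_mul power2_eq_square ac_simps det_diagonal diag_mat_def)
      then show ?thesis
        using detK by (metis mult.left_commute mult.right_neutral)
    qed
    show "a *\<^sub>R K + b *\<^sub>R B \<in> pd_mats \<longleftrightarrow> (\<forall>i. 0 < a + b * d i)" for a b
    proof
      assume "a *\<^sub>R K + b *\<^sub>R B \<in> pd_mats"
      then show "\<forall>i. 0 < a + b * d i"
        unfolding coldot[symmetric] using colne by (simp add: pd_mats_def)
    next
      assume pos: "\<forall>i. 0 < a + b * d i"
      have "0 < x \<bullet> ((a *\<^sub>R K + b *\<^sub>R B) *v x)" if "x \<noteq> 0" for x
      proof -
        define y where "y = R *v x"
        have x: "x = P *v y" by (simp add: y_def matrix_vector_mul_assoc PR)
        then have "y \<noteq> 0" using that by auto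
        then obtain j where "y $ j \<noteq> 0" by (auto simp: vec_eq_iff)
        then have "0 < (\<Sum>i\<in>UNIV. (a + b * d i) * (y $ i)\<^sup>2)"
          using pos by (intro sum_pos2[of _ j]) (auto simp: less_imp_le)
        then show ?thesis
          unfolding x dot_congruence[symmetric] cong dot_diag_mat .
      qed
      then show "a *\<^sub>R K + b *\<^sub>R B \<in> pd_mats" using sym by (simp add: pd_mats_def)
    qed
    show "\<forall>i. 0 \<le> a + b * d i" if "a *\<^sub>R K + b *\<^sub>R B \<in> psd_mats" for a b
      unfolding coldot[symmetric] using that by (simp add: psd_mats_def)
    show "B = c *\<^sub>R K" if "\<forall>i. d i = c" for c
    proof -
      have "d = (\<lambda>i. c)" using that by auto
      have "transpose P ** B ** P = transpose P ** (c *\<^sub>R K) ** P"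
        using cong[of c 0] \<open>d = (\<lambda>i. c)\<close> by (simp add: P(2))
      then show ?thesis using uncong[of B] uncong[of "c *\<^sub>R K"] by simp
    qed
  qed
qed

lemma pd_det_pos: "K \<in> pd_mats \<Longrightarrow> 0 < det K"
  using pencil_eigenvalues pd_mats_imp_sym by metis

lemma psd_det_pos_imp_pd:
  fixes A :: "real^'n^'n"
  assumes "A \<in> psd_mats" "0 < det A"
  shows "A \<in> pd_mats"
proof -
  obtain d :: "'n \<Rightarrow> real" where d: "det A = (\<Prod>i\<in>UNIV. d i)" "A \<in> pd_mats \<longleftrightarrow> (\<forall>i. 0 < d i)" "\<forall>i. 0 \<le> d i"
  proof (rule pencil_eigenvalues[OF mat_1_pd psd_mats_imp_sym[OF assms(1)]], goal_cases)
    case (1 d)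
    from 1(1)[of d] 1(4)[of 0 1] 1(5)[of 0 1] 1(6)[of 0 1] assms show ?case by simp
  qed
  have "d i \<noteq> 0" for i
    using assms(2) d(1) by (metis UNIV_I finite order_less_irrefl prod_zero)
  then show ?thesis using d by (simp add: order_less_le)
qed

text \<open>
  This is strict concavity of \<open>ln det\<close>: the graph lies below its tangent plane at \<open>K\<close>, and touches
  it at \<open>K\<close> only. In terms of the eigenvalues \<open>d\<close> of \<open>M\<close> relative to \<open>K\<close>, the gap is the sum of
  \<open>d i - 1 - ln (d i)\<close>, where each term is non-negative and vanishes only for \<open>d i = 1\<close>.
\<close>

lemma ln_det_le:
  fixes K M :: "real^'n^'n"
  assumes "K \<in> pd_mats" "M \<in> pd_mats"
  shows "ln (det M) - ln (det K) \<le> trace (matrix_inv K ** M) - CARD('n)"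
    and "ln (det M) - ln (det K) = trace (matrix_inv K ** M) - CARD('n) \<Longrightarrow> M = K"
proof -
  obtain d :: "'n \<Rightarrow> real" where K: "0 < det K" and tr: "trace (matrix_inv K ** M) = sum d UNIV"
    and det: "det M = det K * (\<Prod>i\<in>UNIV. d i)" and pos: "\<forall>i. 0 < d i"
    and eq: "(\<forall>i. d i = 1) \<Longrightarrow> M = K"
  proof (rule pencil_eigenvalues[OF assms(1) pd_mats_imp_sym[OF assms(2)]], goal_cases)
    case (1 d)
    from 1(1)[of d] 1(2,3) 1(4)[of 0 1] 1(5)[of 0 1] 1(7)[of 1] assms show ?case by simp
  qed
  have "ln (det M) - ln (det K) = (\<Sum>i\<in>UNIV. ln (d i))"
  proof -
    have "(\<Prod>i\<in>UNIV. d i) > 0" using pos by (simp add: prod_pos)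
    moreover have "ln (\<Prod>i\<in>UNIV. d i) = (\<Sum>i\<in>UNIV. ln (d i))"
      using pos by (intro ln_prod) (auto simp: less_imp_neq[symmetric])
    ultimately show ?thesis
      unfolding det using K by (simp only: ln_mult_pos)
  qed
  then have gap: "trace (matrix_inv K ** M) - CARD('n) - (ln (det M) - ln (det K))
      = (\<Sum>i\<in>UNIV. d i - 1 - ln (d i))"
    by (simp add: tr sum_subtractf)
  have nonneg: "0 \<le> d i - 1 - ln (d i)" for i
    using ln_le_minus_one[of "d i"] pos by simp
  then have "0 \<le> (\<Sum>i\<in>UNIV. d i - 1 - ln (d i))" by (simp add: sum_nonneg)
  with gap show "ln (det M) - ln (det K) \<le> trace (matrix_inv K ** M) - CARD('n)"
    by simp
  assume "ln (det M) - ln (det K) = trace (matrix_inv K ** M) - CARD('n)"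
  with gap have "(\<Sum>i\<in>UNIV. d i - 1 - ln (d i)) = 0" by simp
  then have "d i - 1 - ln (d i) = 0" for i
    using nonneg by (simp add: sum_nonneg_eq_0_iff)
  then have "d i = 1" for i using ln_eq_minus_one[of "d i"] pos by simp
  then show "M = K" using eq by simp
qed

section \<open>Trace products of semidefinite matrices\<close>

lemma psd_factorization:
  fixes A :: "real^'n^'n"
  assumes "A \<in> psd_mats"
  obtains G :: "real^'n^'n" where "A = transpose G ** G"
proof -
  obtain P :: "real^'n^'n" and d :: "'n \<Rightarrow> real" where P: "transpose P ** P = mat 1" "transpose P ** A ** P = diag_mat d"
    by (rule simultaneous_diagonalization[OF mat_1_pd psd_mats_imp_sym[OF assms]]) simp
  then have PP: "P ** transpose P = mat 1" by (simp add: matrix_left_right_inverse)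
  have d: "0 \<le> d i" for i
  proof -
    have "d i = column i P \<bullet> (A *v column i P)"
      using arg_cong[OF P(2), of "\<lambda>A. A $ i $ i"]
      by (simp add: transpose_mult_mult_nth diag_mat_def)
    then show ?thesis using assms by (simp add: psd_mats_def)
  qed
  define D where "D = diag_mat (\<lambda>i. sqrt (d i))"
  have Dt: "transpose D = D"
    by (simp add: D_def diag_mat_def transpose_def vec_eq_iff)
  have D: "D ** D = diag_mat d"
    using d by (simp add: D_def diag_mat_def matrix_matrix_mult_def vec_eq_iff mult_delta_left)
  have "A = (P ** transpose P) ** A ** (P ** transpose P)" by (simp add: PP)
  also have "\<dots> = P ** (transpose P ** A ** P) ** transpose P"
    by (simp only: matrix_mul_assoc)
  also have "\<dots> = transpose (D ** transpose P) ** (D ** transpose P)"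
    by (simp add: P(2) D[symmetric] matrix_transpose_mul Dt matrix_mul_assoc)
  finally show thesis by (rule that)
qed

text \<open>
  Writing a semidefinite matrix as \<open>G\<^sup>T G\<close> turns its trace product with \<open>S\<close> into a sum of values of
  the quadratic form of \<open>S\<close>, which makes the sign of the trace visible.
\<close>

lemma trace_gram_mult:
  fixes G S :: "real^'n^'n"
  shows "trace (transpose G ** G ** S) = (\<Sum>i\<in>UNIV. row i G \<bullet> (S *v row i G))"
proof -
  have "trace (transpose G ** G ** S) = trace (transpose (transpose G) ** S ** transpose G)"
    by (metis matrix_mul_assoc trace_mul_sym transpose_transpose)
  then show ?thesis
    unfolding trace_def transpose_mult_mult_nth by simp
qed

lemma trace_psd_mult_nonneg:
  fixes A S :: "real^'n^'n"
  assumes "A \<in> psd_mats" "S \<in> psd_mats"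
  shows "0 \<le> trace (A ** S)"
proof -
  obtain G :: "real^'n^'n" where "A = transpose G ** G" by (rule psd_factorization[OF assms(1)])
  then show ?thesis
    using assms(2) by (simp add: trace_gram_mult sum_nonneg psd_mats_def)
qed

text \<open>
  If the trace vanishes, then every row of \<open>G\<close> is isotropic for \<open>S\<close> and therefore, as \<open>S\<close> is
  semidefinite, annihilated by \<open>S\<close>; hence \<open>G S = 0\<close>.
\<close>

lemma trace_psd_mult_eq_0_iff:
  fixes A S :: "real^'n^'n"
  assumes "A \<in> psd_mats" "S \<in> psd_mats"
  shows "trace (A ** S) = 0 \<longleftrightarrow> A ** S = 0"
proof
  assume tr: "trace (A ** S) = 0"
  obtain G :: "real^'n^'n" where A: "A = transpose G ** G" by (rule psd_factorization[OF assms(1)])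
  have "row i G \<bullet> (S *v row i G) = 0" for i
    using tr assms(2) unfolding A trace_gram_mult
    by (simp add: psd_mats_def sum_nonneg_eq_0_iff)
  then have "row i G \<bullet> (S *v w) = 0" for i w
    by (rule semidefinite_isotropic_imp_radical[of UNIV S, rotated -1])
      (use assms(2) in \<open>auto simp: psd_mats_def\<close>)
  then have "(row i G v* S) \<bullet> w = 0" for i w by (simp only: dot_lmul_matrix)
  then have rowS: "row i G v* S = 0" for i
    using inner_eq_zero_iff by blast
  have "(G ** S) $ i $ j = (row i G v* S) $ j" for i j
    by (simp add: row_def vector_matrix_mult_def matrix_matrix_mult_def mult.commute)
  then have "G ** S = 0" by (simp add: rowS vec_eq_iff)
  then show "A ** S = 0" by (simp add: A matrix_mul_assoc[symmetric])
next
  assume "A ** S = 0"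
  then show "trace (A ** S) = 0" by (simp add: trace_def)
qed

text \<open>
  The trace is the sum of the eigenvalues of \<open>A\<close> relative to \<open>K\<close>, which are non-negative.
\<close>

lemma trace_matrix_inv_psd_eq_0:
  fixes K A :: "real^'n^'n"
  assumes "K \<in> pd_mats" "A \<in> psd_mats" "trace (matrix_inv K ** A) = 0"
  shows "A = 0"
proof -
  obtain d :: "'n \<Rightarrow> real" where d: "sum d UNIV = 0" "\<forall>i. 0 \<le> d i" "(\<forall>i. d i = 0) \<Longrightarrow> A = 0"
  proof (rule pencil_eigenvalues[OF assms(1) psd_mats_imp_sym[OF assms(2)]], goal_cases)
    case (1 d)
    from 1(1)[of d] 1(3) 1(6)[of 0 1] 1(7)[of 0] assms show ?case by simp
  qed
  then show ?thesis by (simp add: sum_nonneg_eq_0_iff)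
qed

section \<open>Optimality and stationarity\<close>

text \<open>
  Near \<open>t = 0\<close> the function is \<open>ln (det K)\<close> plus the sum of \<open>ln (1 + t d i)\<close>, which has derivative
  \<open>d i\<close> in each term; the radius \<open>e\<close> keeps all arguments of the logarithm positive.
\<close>

lemma ln_det_line_has_derivative:
  fixes K B :: "real^'n^'n"
  assumes "K \<in> pd_mats" "B \<in> sym_mats"
  obtains e where "0 < e" "\<And>t. \<bar>t\<bar> < e \<Longrightarrow> K + t *\<^sub>R B \<in> pd_mats"
    "((\<lambda>t. ln (det (K + t *\<^sub>R B))) has_real_derivative trace (matrix_inv K ** B)) (at 0)"
proof -
  obtain d :: "'n \<Rightarrow> real" where K: "0 < det K" and tr: "trace (matrix_inv K ** B) = sum d UNIV"
    and det: "\<And>t. det (K + t *\<^sub>R B) = det K * (\<Prod>i\<in>UNIV. 1 + t * d i)"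
    and pd: "\<And>t. K + t *\<^sub>R B \<in> pd_mats \<longleftrightarrow> (\<forall>i. 0 < 1 + t * d i)"
  proof (rule pencil_eigenvalues[OF assms], goal_cases)
    case (1 d)
    show ?case
    proof (rule 1(1)[of d])
      fix t
      show "det (K + t *\<^sub>R B) = det K * (\<Prod>i\<in>UNIV. 1 + t * d i)"
        using 1(4)[of 1 t] by simp
      show "K + t *\<^sub>R B \<in> pd_mats \<longleftrightarrow> (\<forall>i. 0 < 1 + t * d i)"
        using 1(5)[of 1 t] by simp
    qed (use 1 in auto)
  qed
  \<comment> \<open>Any radius with \<open>e * \<bar>d i\<bar> < 1\<close> for all \<open>i\<close> would do; the added 1 avoids division by zero.\<close>
  define e where "e = 1 / (1 + (\<Sum>i\<in>UNIV. \<bar>d i\<bar>))"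
  have s0: "0 \<le> (\<Sum>i\<in>UNIV. \<bar>d i\<bar>)" by (simp add: sum_nonneg)
  then have e0: "0 < e" by (simp add: e_def add_pos_nonneg)
  have pos: "0 < 1 + t * d i" if t: "\<bar>t\<bar> < e" for t i
  proof -
    have "\<bar>d i\<bar> \<le> (\<Sum>i\<in>UNIV. \<bar>d i\<bar>)" by (rule member_le_sum) auto
    then have "\<bar>t\<bar> * \<bar>d i\<bar> \<le> \<bar>t\<bar> * (1 + (\<Sum>i\<in>UNIV. \<bar>d i\<bar>))"
      by (intro mult_left_mono) auto
    also have "\<dots> < e * (1 + (\<Sum>i\<in>UNIV. \<bar>d i\<bar>))"
      using t s0 by (intro mult_strict_right_mono add_pos_nonneg) auto
    also have "\<dots> = 1" using add_pos_nonneg[OF zero_less_one s0] by (simp add: e_def)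
    finally have "\<bar>t * d i\<bar> < 1" by (simp add: abs_mult)
    then show ?thesis by linarith
  qed
  have ln: "ln (det (K + t *\<^sub>R B)) = ln (det K) + (\<Sum>i\<in>UNIV. ln (1 + t * d i))"
    if t: "\<bar>t\<bar> < e" for t
  proof -
    have "ln (\<Prod>i\<in>UNIV. 1 + t * d i) = (\<Sum>i\<in>UNIV. ln (1 + t * d i))"
      using pos[OF t] by (intro ln_prod) (auto simp: less_imp_neq[symmetric])
    moreover have "0 < (\<Prod>i\<in>UNIV. 1 + t * d i)" using pos[OF t] by (simp add: prod_pos)
    ultimately show ?thesis unfolding det using K by (simp only: ln_mult_pos)
  qed
  have "((\<lambda>t. ln (det K) + (\<Sum>i\<in>UNIV. ln (1 + t * d i))) has_real_derivative sum d UNIV) (at 0)"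
    by (auto intro!: derivative_eq_intros)
  moreover have "\<forall>\<^sub>F t in nhds 0. ln (det (K + t *\<^sub>R B)) = ln (det K) + (\<Sum>i\<in>UNIV. ln (1 + t * d i))"
    using e0 ln by (auto simp: eventually_nhds_metric dist_real_def)
  ultimately have
    "((\<lambda>t. ln (det (K + t *\<^sub>R B))) has_real_derivative trace (matrix_inv K ** B)) (at 0)"
    unfolding tr by (subst DERIV_cong_ev[OF refl _ refl])
  then show thesis using that e0 pd pos by blast
qed

lemma matrix_inv_sym:
  fixes K :: "real^'n^'n"
  assumes "K \<in> pd_mats"
  shows "matrix_inv K \<in> sym_mats"
proof -
  obtain P :: "real^'n^'n" and d where "transpose P ** K ** P = mat 1" "transpose P ** K ** P = diag_mat d"
    by (rule simultaneous_diagonalization[OF assms pd_mats_imp_sym[OF assms]])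
  then show ?thesis
    by (simp add: matrix_inv_of_congruence_to_identity sym_mats_def matrix_transpose_mul)
qed

lemma trace_matrix_inv_self:
  fixes K :: "real^'n^'n"
  assumes "K \<in> pd_mats"
  shows "trace (matrix_inv K ** K) = CARD('n)"
proof -
  obtain P :: "real^'n^'n" and d where "transpose P ** K ** P = mat 1" "transpose P ** K ** P = diag_mat d"
    by (rule simultaneous_diagonalization[OF assms pd_mats_imp_sym[OF assms]])
  then have "trace (matrix_inv K ** K) = trace (mat 1 :: real^'n^'n)"
    by (metis matrix_inv_of_congruence_to_identity matrix_mul_assoc trace_mul_sym)
  then show ?thesis by (simp add: trace_I)
qed

lemma matrix_diff_rdistrib: "(A - B) ** C = A ** C - B ** (C :: real^'n^'n)"
  by (simp add: matrix_matrix_mult_def vec_eq_iff left_diff_distrib sum_subtractf)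

lemma matrix_diff_ldistrib: "C ** (A - B) = C ** A - C ** (B :: real^'n^'n)"
  by (simp add: matrix_matrix_mult_def vec_eq_iff right_diff_distrib sum_subtractf)

lemma sym_perp_diff_matrix_inv_iff:
  fixes S K :: "real^'n^'n"
  assumes "S \<in> sym_mats" "K \<in> pd_mats"
  shows "S - matrix_inv K \<in> sym_perp L \<longleftrightarrow> (\<forall>B\<in>L. trace (S ** B) = trace (matrix_inv K ** B))"
proof -
  have "S - matrix_inv K \<in> sym_mats"
    using assms(1) matrix_inv_sym[OF assms(2)] by (simp add: sym_mats_def transpose_def vec_eq_iff)
  then show ?thesis by (simp add: sym_perp_def matrix_diff_rdistrib trace_sub)
qed

text \<open>
  The optimum lies in the interior of the cone, so both directions \<open>B\<close> and \<open>- B\<close> are feasible and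
  the derivative of the objective along \<open>B\<close> vanishes.
\<close>

lemma optimum_imp_stationary:
  fixes S K :: "real^'n^'n"
  assumes "subspace L" "L \<subseteq> sym_mats" "is_optimum S L K" "B \<in> L"
  shows "trace (S ** B) = trace (matrix_inv K ** B)"
proof -
  have K: "K \<in> pd_mats" "K \<in> L"
    and min: "\<And>M. M \<in> pd_mats \<Longrightarrow> M \<in> L \<Longrightarrow> objective S K \<le> objective S M"
    using assms(3) unfolding is_optimum_def is_arg_min_def by (auto simp: not_less)
  obtain e where e: "0 < e" "\<And>t. \<bar>t\<bar> < e \<Longrightarrow> K + t *\<^sub>R B \<in> pd_mats"
    and D: "((\<lambda>t. ln (det (K + t *\<^sub>R B))) has_real_derivative trace (matrix_inv K ** B)) (at 0)"
    by (rule ln_det_line_has_derivative[of K B]) (use K assms in auto)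
  have lin: "trace (S ** (K + t *\<^sub>R B)) = trace (S ** K) + t * trace (S ** B)" for t
    by (simp add: matrix_add_ldistrib trace_add matrix_scalar_ac scalar_matrix_assoc[symmetric]
        trace_scaleR)
  have "((\<lambda>t. objective S (K + t *\<^sub>R B)) has_real_derivative
      trace (S ** B) - trace (matrix_inv K ** B)) (at 0)"
    unfolding objective_def lin by (intro DERIV_diff[OF _ D]) (auto intro!: derivative_eq_intros)
  moreover have "objective S (K + 0 *\<^sub>R B) \<le> objective S (K + t *\<^sub>R B)" if "\<bar>0 - t\<bar> < e" for t
    using that e K assms by (auto intro!: min simp: subspace_add subspace_mul)
  ultimately have "trace (S ** B) - trace (matrix_inv K ** B) = 0"
    using e(1) by (intro DERIV_local_min) auto
  then show ?thesis by simp
qed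

text \<open>
  Stationarity makes the linear part of the objective change from \<open>K\<close> to \<open>M\<close> by exactly the amount
  by which the tangent of \<open>ln det\<close> at \<open>K\<close> changes. The difference of the two objective values is
  therefore the gap in the strict concavity of \<open>ln det\<close>.
\<close>

lemma stationary_imp_less:
  fixes S K M :: "real^'n^'n"
  assumes "subspace L" "K \<in> L" "K \<in> pd_mats" "M \<in> L" "M \<in> pd_mats" "M \<noteq> K"
    and "\<And>B. B \<in> L \<Longrightarrow> trace (S ** B) = trace (matrix_inv K ** B)"
  shows "objective S K < objective S M"
proof -
  have "trace (S ** (M - K)) = trace (matrix_inv K ** (M - K))"
    by (rule assms(7)) (use assms in \<open>simp add: subspace_diff\<close>)
  then have "trace (S ** M) - trace (S ** K) = trace (matrix_inv K ** M) - CARD('n)"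
    by (simp add: matrix_diff_ldistrib trace_sub trace_matrix_inv_self[OF assms(3)])
  moreover have "ln (det M) - ln (det K) < trace (matrix_inv K ** M) - CARD('n)"
    using ln_det_le[OF assms(3,5)] assms(6) by linarith
  ultimately show ?thesis by (simp add: objective_def)
qed

lemma optimum_iff_stationary:
  fixes S K :: "real^'n^'n"
  assumes "S \<in> sym_mats" "subspace L" "L \<subseteq> sym_mats"
  shows "is_optimum S L K \<longleftrightarrow> K \<in> L \<inter> pd_mats \<and> S - matrix_inv K \<in> sym_perp L"
proof
  assume opt: "is_optimum S L K"
  then have K: "K \<in> L \<inter> pd_mats"
    by (simp add: is_optimum_def is_arg_min_def)
  then show "K \<in> L \<inter> pd_mats \<and> S - matrix_inv K \<in> sym_perp L"
    using optimum_imp_stationary[OF assms(2,3) opt] sym_perp_diff_matrix_inv_iff[OF assms(1)] by simp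
next
  assume K: "K \<in> L \<inter> pd_mats \<and> S - matrix_inv K \<in> sym_perp L"
  then have st: "\<And>B. B \<in> L \<Longrightarrow> trace (S ** B) = trace (matrix_inv K ** B)"
    using sym_perp_diff_matrix_inv_iff[OF assms(1)] by blast
  have "\<not> objective S M < objective S K" if "M \<in> pd_mats" "M \<in> L" for M
    using stationary_imp_less[OF assms(2) _ _ that(2,1) _ st] K by fastforce
  then show "is_optimum S L K"
    using K by (auto simp: is_optimum_def is_arg_min_def)
qed

lemma optimum_unique:
  fixes S :: "real^'n^'n"
  assumes "subspace L" "L \<subseteq> sym_mats" "is_optimum S L K" "is_optimum S L M"
  shows "M = K"
proof (rule ccontr)
  assume "M \<noteq> K"
  have "K \<in> L" "K \<in> pd_mats" "M \<in> L" "M \<in> pd_mats" "\<not> objective S K < objective S M"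
    using assms(3,4) by (auto simp: is_optimum_def is_arg_min_def)
  then show False
    using stationary_imp_less[OF assms(1) _ _ _ _ \<open>M \<noteq> K\<close> optimum_imp_stationary[OF assms(1-3)]]
    by blast
qed

section \<open>Existence of an optimum\<close>

lemma closed_psd_mats: "closed (psd_mats :: (real^'n^'n) set)"
proof -
  have "closed {A :: real^'n^'n. transpose A = A}"
    unfolding transpose_def by (intro closed_Collect_eq continuous_intros)
  moreover have "closed {A :: real^'n^'n. 0 \<le> x \<bullet> (A *v x)}" for x
    unfolding matrix_vector_mult_def by (intro closed_Collect_le continuous_intros)
  ultimately have "closed ({A :: real^'n^'n. transpose A = A} \<inter> (\<Inter>x. {A. 0 \<le> x \<bullet> (A *v x)}))"
    by (intro closed_Int closed_INT ballI)
  also have "{A :: real^'n^'n. transpose A = A} \<inter> (\<Inter>x. {A. 0 \<le> x \<bullet> (A *v x)}) = psd_mats"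
    by (auto simp: psd_mats_def sym_mats_def)
  finally show ?thesis .
qed

lemma continuous_on_trace_mult: "continuous_on U (\<lambda>A. trace (A ** (S :: real^'n^'n)))"
  unfolding trace_def matrix_matrix_mult_def by (simp, intro continuous_intros)

lemma continuous_on_det: "continuous_on U (det :: real^'n^'n \<Rightarrow> real)"
  unfolding det_def by (intro continuous_intros)

text \<open>
  The hypothesis makes \<open>Tr (A S)\<close> positive on the compact set of semidefinite unit vectors of \<open>L\<close>. Its
  minimum there is the constant \<open>c\<close> (if the set is empty, any \<open>c\<close> serves), and homogeneity gives the
  rest.
\<close>

lemma trace_coercive:
  fixes S :: "real^'n^'n"
  assumes S: "S \<in> psd_mats" and L: "subspace L"
    and no: "\<not> (\<exists>\<Omega>\<in>psd_mats \<inter> L. \<Omega> \<noteq> 0 \<and> trace (\<Omega> ** S) = 0)"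
  obtains c where "0 < c" "\<And>A. A \<in> psd_mats \<Longrightarrow> A \<in> L \<Longrightarrow> c * norm A \<le> trace (A ** S)"
proof -
  let ?T = "psd_mats \<inter> L \<inter> sphere 0 1"
  have pos: "0 < trace (A ** S)" if "A \<in> ?T" for A
  proof -
    have "A \<noteq> 0" using that by auto
    then show ?thesis
      using that no trace_psd_mult_nonneg[OF _ S, of A] by (auto simp: order_less_le)
  qed
  have "compact ?T"
    by (intro closed_Int_compact closed_Int closed_psd_mats closed_subspace L) simp
  have "\<exists>c>0. \<forall>A\<in>?T. c \<le> trace (A ** S)"
  proof (cases "?T = {}")
    case False
    with \<open>compact ?T\<close> obtain A where "A \<in> ?T" "\<forall>M\<in>?T. trace (A ** S) \<le> trace (M ** S)"
      using continuous_attains_inf[OF _ _ continuous_on_trace_mult[of ?T S]] by blast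
    then show ?thesis using pos by blast
  qed (auto intro: exI[of _ 1])
  then obtain c where c: "0 < c" "\<And>A. A \<in> ?T \<Longrightarrow> c \<le> trace (A ** S)" by blast
  have "c * norm A \<le> trace (A ** S)" if A: "A \<in> psd_mats" "A \<in> L" for A
  proof (cases "A = 0")
    case False
    have "(1 / norm A) *\<^sub>R A \<in> psd_mats"
      using A(1) by (simp add: psd_mats_def sym_mats_def transpose_scalar
          scaleR_matrix_vector_assoc[symmetric])
    then have "(1 / norm A) *\<^sub>R A \<in> ?T"
      using False A(2) L by (simp add: subspace_mul)
    from c(2)[OF this] have "c \<le> trace (A ** S) / norm A"
      by (simp add: scalar_matrix_assoc[symmetric] trace_scaleR)
    then show ?thesis using False by (simp add: pos_le_divide_eq)
  qed (simp add: trace_def)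
  with c(1) show thesis by (rule that)
qed

text \<open>
  The term \<open>ln det\<close> grows more slowly than any positive multiple of the norm. The bound is the tangent
  plane of \<open>ln det\<close> at a large multiple of the identity, where its slope is small.
\<close>

lemma ln_det_le_norm:
  fixes c :: real
  assumes "0 < c"
  obtains C where "\<And>M :: real^'n^'n. M \<in> pd_mats \<Longrightarrow> ln (det M) \<le> C + c * norm M"
proof -
  \<comment> \<open>The linear part of the tangent at \<open>K = (1 / t) I\<close> is \<open>t Tr M\<close>, and \<open>Tr M\<close> is at most \<open>n\<close> times the norm of \<open>M\<close>.\<close>
  define t where "t = c / CARD('n)"
  have t: "0 < t" using assms by (simp add: t_def)
  define K :: "real^'n^'n" where "K = (1 / t) *\<^sub>R mat 1"
  have K: "K \<in> pd_mats"
    using mat_1_pd t by (simp add: K_def pd_mats_def sym_mats_def transpose_scalar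
        scaleR_matrix_vector_assoc[symmetric])
  have inv: "matrix_inv K = t *\<^sub>R mat 1"
    by (rule matrix_inv_eqI)
      (use t in \<open>simp add: K_def matrix_scalar_ac scalar_matrix_assoc[symmetric]\<close>)
  have "ln (det M) \<le> (ln (det K) - CARD('n)) + c * norm M" if M: "M \<in> pd_mats" for M :: "real^'n^'n"
  proof -
    have "M $ i $ i \<le> norm M" for i
      using component_le_norm_cart[of "M $ i" i] Finite_Cartesian_Product.norm_nth_le[of M i] by linarith
    then have "trace M \<le> CARD('n) * norm M"
      unfolding trace_def using sum_bounded_above[of "UNIV :: 'n set" "\<lambda>i. M $ i $ i" "norm M"] by simp
    then have "t * trace M \<le> t * (CARD('n) * norm M)"
      using t by (intro mult_left_mono) auto
    also have "\<dots> = c * norm M" by (simp add: t_def)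
    finally have "t * trace M \<le> c * norm M" .
    moreover have "trace (matrix_inv K ** M) = t * trace M"
      by (simp add: inv scalar_matrix_assoc[symmetric] trace_scaleR)
    ultimately show ?thesis using ln_det_le(1)[OF K M] by simp
  qed
  then show thesis by (rule that)
qed

text \<open>
  The trace grows at least like \<open>c \<parallel>M\<parallel>\<close> and \<open>ln det\<close> at most like \<open>c / 2 \<parallel>M\<parallel>\<close>, so the sublevel set of
  the objective at the value \<open>\<alpha>\<close> of some feasible matrix is bounded. On this set the determinant is
  at least \<open>exp (- \<alpha>)\<close>, since the trace term is non-negative; this keeps the set away from the
  singular matrices. The sublevel set thus lies in a compact set \<open>T\<close> of definite matrices, on which
  the continuous objective attains its minimum.
\<close>

lemma optimum_exists:
  fixes S :: "real^'n^'n"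
  assumes S: "S \<in> psd_mats" and L: "subspace L" and ne: "L \<inter> pd_mats \<noteq> {}"
    and no: "\<not> (\<exists>\<Omega>\<in>psd_mats \<inter> L. \<Omega> \<noteq> 0 \<and> trace (\<Omega> ** S) = 0)"
  shows "\<exists>K. is_optimum S L K"
proof -
  obtain c where c: "0 < c" "\<And>A. A \<in> psd_mats \<Longrightarrow> A \<in> L \<Longrightarrow> c * norm A \<le> trace (A ** S)"
    by (rule trace_coercive[OF S L no]) blast
  obtain C where C: "\<And>M :: real^'n^'n. M \<in> pd_mats \<Longrightarrow> ln (det M) \<le> C + c / 2 * norm M"
    by (rule ln_det_le_norm[of "c / 2", where 'n = 'n]) (use c(1) in auto)
  obtain K0 where K0: "K0 \<in> L" "K0 \<in> pd_mats" using ne by blast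
  define \<alpha> where "\<alpha> = objective S K0"
  define R where "R = 2 * (\<alpha> + C) / c"
  define T where "T = psd_mats \<inter> L \<inter> {M. exp (- \<alpha>) \<le> det M} \<inter> cball 0 R"
  have "closed {M :: real^'n^'n. exp (- \<alpha>) \<le> det M}"
    by (intro closed_Collect_le continuous_on_det continuous_intros)
  then have "compact T"
    by (simp add: T_def closed_Int_compact closed_Int closed_psd_mats closed_subspace L)
  have T_pd: "M \<in> pd_mats" if "M \<in> T" for M
  proof (rule psd_det_pos_imp_pd)
    show "0 < det M" using that less_le_trans[OF exp_gt_zero[of "- \<alpha>"], of "det M"]
      by (simp add: T_def)
  qed (use that in \<open>simp add: T_def\<close>)
  have sublevel: "M \<in> T" if M: "M \<in> L" "M \<in> pd_mats" "objective S M \<le> \<alpha>" for M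
  proof -
    note psd = pd_mats_imp_psd[OF M(2)]
    have obj: "trace (M ** S) - ln (det M) \<le> \<alpha>"
      using M(3) by (simp add: objective_def trace_mul_sym[of S M])
    have "c * norm M \<le> \<alpha> + C + c / 2 * norm M"
      using c(2)[OF psd M(1)] C[OF M(2)] obj by linarith
    then have "norm M \<le> R" using c(1) by (simp add: R_def field_simps)
    moreover have "- \<alpha> \<le> ln (det M)"
      using trace_psd_mult_nonneg[OF psd S] obj by linarith
    then have "exp (- \<alpha>) \<le> det M"
      using pd_det_pos[OF M(2)] by (simp add: ln_ge_iff)
    ultimately show ?thesis using psd M(1) by (simp add: T_def)
  qed
  have "continuous_on T (objective S)"
  proof -
    have "det M \<noteq> 0" if "M \<in> T" for M using pd_det_pos[OF T_pd[OF that]] by simp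
    then show ?thesis
      unfolding objective_def trace_mul_sym[of S]
      by (intro continuous_intros continuous_on_trace_mult continuous_on_det) auto
  qed
  moreover have "K0 \<in> T" using sublevel[OF K0] by (simp add: \<alpha>_def)
  ultimately obtain K where K: "K \<in> T" "\<And>M. M \<in> T \<Longrightarrow> objective S K \<le> objective S M"
    using continuous_attains_inf[OF \<open>compact T\<close>, of "objective S"] by blast
  have "objective S K \<le> objective S M" if "M \<in> pd_mats" "M \<in> L" for M
  proof (cases "objective S M \<le> \<alpha>")
    case True
    then show ?thesis using K(2) sublevel that by blast
  next
    case False
    then show ?thesis using K(2)[OF \<open>K0 \<in> T\<close>] by (simp add: \<alpha>_def)
  qed
  moreover have "K \<in> pd_mats" "K \<in> L" using T_pd[OF K(1)] K(1) by (auto simp: T_def)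
  ultimately show ?thesis
    unfolding is_optimum_def is_arg_min_def by (auto simp: not_less)
qed

text \<open>
  Testing \<open>S - K^{-1}\<close> against \<open>\<Omega>\<close> in \<open>L\<close> turns \<open>Tr (\<Omega> S) = 0\<close> into \<open>Tr (K^{-1} \<Omega>) = 0\<close>, which a definite \<open>K\<close>
  excludes for non-zero semidefinite \<open>\<Omega>\<close>.
\<close>

lemma stationary_imp_no_recession:
  fixes S K :: "real^'n^'n"
  assumes "K \<in> pd_mats" "S - matrix_inv K \<in> sym_perp L"
    and "\<Omega> \<in> psd_mats" "\<Omega> \<in> L" "trace (\<Omega> ** S) = 0"
  shows "\<Omega> = 0"
proof (rule trace_matrix_inv_psd_eq_0[OF assms(1,3)])
  have "trace ((S - matrix_inv K) ** \<Omega>) = 0"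
    using assms(2,4) by (simp add: sym_perp_def)
  then show "trace (matrix_inv K ** \<Omega>) = 0"
    using assms(5) by (simp add: matrix_diff_rdistrib trace_sub trace_mul_sym[of \<Omega> S])
qed

theorem theorem2p1:
  fixes S :: "real^'n^'n" and L :: "(real^'n^'n) set"
  assumes "S \<in> psd_mats - {0}"
    and "subspace L" and "L \<subseteq> sym_mats"
    and "L \<inter> pd_mats \<noteq> {}"
  shows "((\<exists>K. is_optimum S L K) \<longleftrightarrow> (\<exists>!K. is_optimum S L K))
    \<and> ((\<exists>K. is_optimum S L K) \<longleftrightarrow> (\<exists>K\<in>pd_mats. S - matrix_inv K \<in> sym_perp L))
    \<and> ((\<exists>K\<in>pd_mats. S - matrix_inv K \<in> sym_perp L)
        \<longleftrightarrow> \<not> (\<exists>\<Omega>\<in>psd_mats \<inter> L. \<Omega> \<noteq> 0 \<and> trace (\<Omega> ** S) = 0))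
    \<and> (\<forall>\<Omega>\<in>psd_mats \<inter> L. trace (\<Omega> ** S) = 0 \<longleftrightarrow> \<Omega> ** S = 0)
    \<and> ((\<exists>K. is_optimum S L K) \<longrightarrow>
        (\<exists>!K. K \<in> L \<inter> pd_mats \<and> S - matrix_inv K \<in> sym_perp L)
        \<and> (\<forall>K. is_optimum S L K \<longleftrightarrow> K \<in> L \<inter> pd_mats \<and> S - matrix_inv K \<in> sym_perp L))"
proof -
  have S: "S \<in> psd_mats" using assms(1) by simp
  note opt_iff = optimum_iff_stationary[OF psd_mats_imp_sym[OF S] assms(2,3)]
  have unique: "(\<exists>K. is_optimum S L K) \<longleftrightarrow> (\<exists>!K. is_optimum S L K)"
    using optimum_unique[OF assms(2,3)] by blast
  have 12: "\<exists>K\<in>pd_mats. S - matrix_inv K \<in> sym_perp L" if "\<exists>K. is_optimum S L K"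
    using that opt_iff by blast
  have 23: "\<not> (\<exists>\<Omega>\<in>psd_mats \<inter> L. \<Omega> \<noteq> 0 \<and> trace (\<Omega> ** S) = 0)"
    if "\<exists>K\<in>pd_mats. S - matrix_inv K \<in> sym_perp L"
    using that stationary_imp_no_recession by blast
  have 31: "\<exists>K. is_optimum S L K" if "\<not> (\<exists>\<Omega>\<in>psd_mats \<inter> L. \<Omega> \<noteq> 0 \<and> trace (\<Omega> ** S) = 0)"
    by (rule optimum_exists[OF S assms(2,4) that])
  have null: "\<forall>\<Omega>\<in>psd_mats \<inter> L. trace (\<Omega> ** S) = 0 \<longleftrightarrow> \<Omega> ** S = 0"
    using trace_psd_mult_eq_0_iff[OF _ S] by blast
  have optimum: "(\<exists>K. is_optimum S L K) \<longrightarrow>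
        (\<exists>!K. K \<in> L \<inter> pd_mats \<and> S - matrix_inv K \<in> sym_perp L)
        \<and> (\<forall>K. is_optimum S L K \<longleftrightarrow> K \<in> L \<inter> pd_mats \<and> S - matrix_inv K \<in> sym_perp L)"
    using unique unfolding opt_iff by simp
  show ?thesis
    using unique 12 23 31 null optimum by argo
qed

end
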